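(* For any analytic equivalence relation $E$ on a Polish space $Y$, either $E_0^{\mathbb{N}}\le_B E$ or $E_0^{\mathbb{N}}$ is prime to $E$. In particular, $E_0^{\mathbb{N}}$ is prime.
   Context: $E_0$ is eventual equality on $2^{\mathbb{N}}$; $E_0^{\mathbb{N}}$ is the product equivalence relation on $(2^{\mathbb{N}})^{\mathbb{N}}$: $x\mathrel{E_0^{\mathbb{N}}}y$ iff $x(n)\mathrel{E_0}y(n)$ for all $n$. A map $f$ is a homomorphism from $E$ to $F$ if $x_1\mathrel{E}x_2\Rightarrow f(x_1)\mathrel{F}f(x_2)$; a reduction if moreover the converse holds; $E\le_B F$ means there is a Borel reduction from $E$ to $F$. For an equivalence relation $E'$ on a Polish space $X$ and an equivalence relation $F$ on a Polish space $Y$, $E'$ is prime to $F$ if for every Borel homomorphism $f\colon X\to Y$ from $E'$ to $F$ there is $y\in Y$ such that $E'\le_B E'\restriction\{x\in X: f(x)\mathrel{F}y\}$. A Borel equivalence relation $E'$ is prime if for every Borel equivalence relation $F$, either $E'\le_B F$ or $E'$ is prime to $F$. *)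

theory Defs
  imports "HOL-Analysis.Analysis"
begin

text \<open>
  A relation lives on the space of a measure, of which only the underlying \<open>\<sigma>\<close>-algebra matters:
  \<^term>\<open>borel\<close> for a whole topological space, \<^term>\<open>restrict_space borel A\<close> for an arbitrary
  subset \<open>A\<close> with the relative Borel structure.
\<close>

definition rel_hom :: "'a rel \<Rightarrow> 'b rel \<Rightarrow> ('a \<Rightarrow> 'b) \<Rightarrow> bool" where
  "rel_hom E F f \<longleftrightarrow> (\<forall>x y. (x, y) \<in> E \<longrightarrow> (f x, f y) \<in> F)"

definition borel_reducible :: "'a measure \<Rightarrow> 'a rel \<Rightarrow> 'b measure \<Rightarrow> 'b rel \<Rightarrow> bool" where
  "borel_reducible M E N F \<longleftrightarrow>
     (\<exists>f \<in> measurable M N. \<forall>x\<in>space M. \<forall>y\<in>space M. (x, y) \<in> E \<longleftrightarrow> (f x, f y) \<in> F)"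

text \<open>
  Analytic sets are the projections of Borel sets along a Polish space; the Baire space serves as the
  fixed witness, since type quantification is unavailable and every nonempty Polish space is a continuous image of it.
\<close>

definition analytic_set :: "'a::topological_space set \<Rightarrow> bool" where
  "analytic_set A \<longleftrightarrow> (\<exists>B \<in> sets (borel :: ('a \<times> (nat \<Rightarrow> nat)) measure). A = fst ` B)"

definition analytic_equiv :: "'a::topological_space rel \<Rightarrow> bool" where
  "analytic_equiv E \<longleftrightarrow> equiv UNIV E \<and> analytic_set E"

definition borel_equiv :: "'a::topological_space rel \<Rightarrow> bool" where
  "borel_equiv E \<longleftrightarrow> equiv UNIV E \<and> E \<in> sets borel"

definition prime_to :: "'a::topological_space rel \<Rightarrow> 'b::topological_space rel \<Rightarrow> bool" where
  "prime_to E F \<longleftrightarrow>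
     (\<forall>f \<in> borel_measurable borel. rel_hom E F f \<longrightarrow>
        (\<exists>y. borel_reducible borel E
               (restrict_space borel {x. (f x, y) \<in> F})
               (Restr E {x. (f x, y) \<in> F})))"

text \<open>
  Primeness quantifies over all Polish spaces. Since HOL has no quantifier over types, the target
  space is a type argument, to be left as a type variable when primeness is asserted.
\<close>

definition prime_equiv :: "'b::polish_space itself \<Rightarrow> 'a::topological_space rel \<Rightarrow> bool" where
  "prime_equiv _ E \<longleftrightarrow> borel_equiv E \<and>
     (\<forall>F :: 'b rel. borel_equiv F \<longrightarrow> borel_reducible borel E borel F \<or> prime_to E F)"

definition E0 :: "(nat \<Rightarrow> bool) rel" where
  "E0 = {(x, y). \<forall>\<^sub>F k in sequentially. x k = y k}"

text \<open>
  The function type carries the product topology, and the order topology of \<^typ>\<open>bool\<close> is discrete,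
  so \<^typ>\<open>nat \<Rightarrow> nat \<Rightarrow> bool\<close> is the Polish space of sequences in the Cantor space. (It is not an
  instance of \<^class>\<open>polish_space\<close> only because \<^typ>\<open>bool\<close> has no metric instance.)
\<close>

definition E0N :: "(nat \<Rightarrow> nat \<Rightarrow> bool) rel" where
  "E0N = {(x, y). \<forall>n. (x n, y n) \<in> E0}"

end

theory Submission
  imports Defs
begin

text \<open>
  For a Borel homomorphism \<open>f\<close> from \<^const>\<open>E0N\<close> to \<open>E\<close>, let \<open>R n\<close> be the set of pairs \<open>(u, v)\<close> such that
  replacing the rows of \<open>u\<close> from \<open>n\<close> on by those of \<open>v\<close> does not change the \<open>E\<close>-class of the value of \<open>f\<close>.
  These sets are analytic and hence have the Baire property.

  If some \<open>R n\<close> is nonmeager, it is comeager in a basic open set. One fixes \<open>u\<close> there and codes an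
  arbitrary point into the rows from \<open>n\<close> on, keeping on suitable finite blocks the patterns that force
  membership in \<open>R n\<close>: this reduces \<^const>\<open>E0N\<close> to itself within a single \<open>f\<close>-preimage of an \<open>E\<close>-class.

  If all \<open>R n\<close> are meager, there are disjoint finite blocks indexed by \<open>(n, l)\<close>, each with two patterns
  forcing a pair out of the \<open>l\<close>-th nowhere dense set covering \<open>R n\<close>. The map \<open>\<phi>\<close> that selects the pattern
  on block \<open>(n, l)\<close> by the bit \<open>x n l\<close>, in the rows from \<open>n\<close> on only, is a homomorphism of \<^const>\<open>E0N\<close>, and
  \<open>f \<circ> \<phi>\<close> is a reduction: look at the first row where two points are not \<^const>\<open>E0\<close>-equivalent.
  Since row \<open>k\<close> of \<open>\<phi> x\<close> depends only on the rows of \<open>x\<close> up to \<open>k\<close>, countably many sets \<open>R n\<close> suffice.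
\<close>

section \<open>Product topologies over discrete spaces\<close>

text \<open>Makes countable powers of \<open>bool\<close> second countable, as the category
  arguments below require.\<close>

instance bool :: second_countable_topology
proof
  have "open = generate_topology (UNIV :: bool set set)"
    by (auto simp: fun_eq_iff open_discrete intro: generate_topology.Basis)
  then show "\<exists>B::bool set set. countable B \<and> open = generate_topology B"
    by (intro exI[of _ UNIV]) (auto intro: countable_finite)
qed

lemma open_fun_finite_agree:
  fixes V :: "('i \<Rightarrow> 'b::topological_space) set"
  assumes "open V" "x \<in> V"
  obtains J where "finite J" "\<And>y. (\<And>i. i \<in> J \<Longrightarrow> y i = x i) \<Longrightarrow> y \<in> V"
proof -
  have "openin (product_topology (\<lambda>i. euclidean) UNIV) V"
    using assms(1) by (simp add: open_fun_def)
  from product_topology_open_contains_basis[OF this assms(2)] obtain X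
    where X: "x \<in> Pi\<^sub>E UNIV X" "finite {i. X i \<noteq> UNIV}" "Pi\<^sub>E UNIV X \<subseteq> V"
    by auto
  show thesis
  proof
    show "finite {i. X i \<noteq> UNIV}" by (rule X(2))
    fix y assume y: "y i = x i" if "i \<in> {i. X i \<noteq> UNIV}" for i
    have "y i \<in> X i" for i
    proof (cases "X i = UNIV")
      case False
      then have "y i = x i" using y by simp
      then show ?thesis using X(1) by (simp add: PiE_iff)
    qed simp
    then show "y \<in> V" using X(3) by (auto simp: PiE_iff)
  qed
qed

lemma open_cylinder:
  fixes p :: "'i \<Rightarrow> 'b::discrete_topology"
  shows "finite J \<Longrightarrow> open {x. \<forall>i\<in>J. x i = p i}"
  using product_topology_basis'[of J "\<lambda>i. {p i}" "\<lambda>i. i"] by (simp add: open_discrete)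

lemma continuous_on_snd_apply:
  "continuous_on UNIV (\<lambda>p :: 'a::topological_space \<times> ('i \<Rightarrow> 'b::topological_space). snd p i)"
  by (rule continuous_on_product_then_coordinatewise[OF continuous_on_snd[OF continuous_on_id]])

lemma continuous_on_discrete_comp:
  fixes g :: "'b::discrete_topology \<Rightarrow> 'c::topological_space"
  assumes "continuous_on S f"
  shows "continuous_on S (\<lambda>x. g (f x))"
proof -
  have "continuous_on UNIV g"
    by (simp add: continuous_on_open_vimage open_discrete)
  then show ?thesis
    using assms by (rule continuous_on_compose2) simp
qed

section \<open>The Baire property of analytic sets\<close>

definition nowhere_dense :: "'a::topological_space set \<Rightarrow> bool" where
  "nowhere_dense T \<longleftrightarrow> interior (closure T) = {}"

definition meager :: "'a::topological_space set \<Rightarrow> bool" where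
  "meager S \<longleftrightarrow> (\<exists>T :: nat \<Rightarrow> 'a set. (\<forall>n. nowhere_dense (T n)) \<and> S \<subseteq> (\<Union>n. T n))"

lemma nowhere_dense_iff:
  "nowhere_dense T \<longleftrightarrow>
     (\<forall>V. open V \<and> V \<noteq> {} \<longrightarrow> (\<exists>W. open W \<and> W \<noteq> {} \<and> W \<subseteq> V \<and> W \<inter> T = {}))"
proof
  assume nd: "nowhere_dense T"
  show "\<forall>V. open V \<and> V \<noteq> {} \<longrightarrow> (\<exists>W. open W \<and> W \<noteq> {} \<and> W \<subseteq> V \<and> W \<inter> T = {})"
  proof (intro allI impI)
    fix V :: "'a set"
    assume V: "open V \<and> V \<noteq> {}"
    then have "\<not> V \<subseteq> closure T"
      using nd interior_maximal unfolding nowhere_dense_def by blast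
    with V show "\<exists>W. open W \<and> W \<noteq> {} \<and> W \<subseteq> V \<and> W \<inter> T = {}"
      using closure_subset[of T] by (intro exI[of _ "V - closure T"]) (auto simp: open_Diff)
  qed
next
  assume *: "\<forall>V. open V \<and> V \<noteq> {} \<longrightarrow> (\<exists>W. open W \<and> W \<noteq> {} \<and> W \<subseteq> V \<and> W \<inter> T = {})"
  show "nowhere_dense T"
    unfolding nowhere_dense_def
  proof (rule ccontr)
    assume "interior (closure T) \<noteq> {}"
    then obtain W where "open W" "W \<noteq> {}" "W \<subseteq> interior (closure T)" "W \<inter> T = {}"
      using spec[OF *, of "interior (closure T)"] by auto
    then show False
      using open_Int_closure_eq_empty[of W T] interior_subset[of "closure T"] by blast
  qed
qed

lemma nowhere_denseE:
  assumes "nowhere_dense T" "open V" "V \<noteq> {}"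
  obtains W where "open W" "W \<noteq> {}" "W \<subseteq> V" "W \<inter> T = {}"
proof -
  have "\<exists>W. open W \<and> W \<noteq> {} \<and> W \<subseteq> V \<and> W \<inter> T = {}"
    using assms nowhere_dense_iff[of T] by simp
  then show thesis using that by (elim exE conjE)
qed

lemma nowhere_dense_Un:
  assumes "nowhere_dense S" "nowhere_dense T"
  shows "nowhere_dense (S \<union> T)"
  unfolding nowhere_dense_iff
proof (intro allI impI)
  fix V :: "'a set"
  assume "open V \<and> V \<noteq> {}"
  then obtain W where W: "open W" "W \<noteq> {}" "W \<subseteq> V" "W \<inter> S = {}"
    using nowhere_denseE[OF assms(1)] by metis
  obtain W' where "open W'" "W' \<noteq> {}" "W' \<subseteq> W" "W' \<inter> T = {}"
    using nowhere_denseE[OF assms(2) W(1,2)] by metis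
  then show "\<exists>W. open W \<and> W \<noteq> {} \<and> W \<subseteq> V \<and> W \<inter> (S \<union> T) = {}"
    using W(3,4) by (intro exI[of _ W'] conjI) auto
qed

lemma nowhere_dense_imp_meager: "nowhere_dense S \<Longrightarrow> meager S"
  unfolding meager_def by (intro exI[of _ "\<lambda>_. S"]) simp

lemma meager_subset: "meager T \<Longrightarrow> S \<subseteq> T \<Longrightarrow> meager S"
  unfolding meager_def by (meson order_trans)

lemma meager_UN_nat:
  assumes "\<And>i::nat. meager (S i)"
  shows "meager (\<Union>i. S i)"
proof -
  obtain T :: "nat \<Rightarrow> nat \<Rightarrow> 'a set"
    where T: "\<And>i n. nowhere_dense (T i n)" "\<And>i. S i \<subseteq> (\<Union>n. T i n)"
    using assms unfolding meager_def by metis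
  have "(\<Union>i. S i) \<subseteq> (\<Union>k. case prod_decode k of (i, n) \<Rightarrow> T i n)"
  proof
    fix x assume "x \<in> (\<Union>i. S i)"
    then obtain i n where "x \<in> T i n" using T(2) by blast
    then show "x \<in> (\<Union>k. case prod_decode k of (i, n) \<Rightarrow> T i n)"
      by (intro UN_I[of "prod_encode (i, n)"]) auto
  qed
  then show ?thesis
    unfolding meager_def using T(1)
    by (intro exI[of _ "\<lambda>k. case prod_decode k of (i, n) \<Rightarrow> T i n"]) (auto split: prod.split)
qed

lemma meager_empty: "meager {}"
  by (rule nowhere_dense_imp_meager) (simp add: nowhere_dense_def)

lemma meager_UN:
  assumes "countable I" "\<And>i. i \<in> I \<Longrightarrow> meager (S i)"
  shows "meager (\<Union>i\<in>I. S i)"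
proof (cases "I = {}")
  case True
  then show ?thesis by (simp add: meager_empty)
next
  case False
  have "meager (\<Union>n. S (from_nat_into I n))"
    using assms False by (intro meager_UN_nat) (auto simp: from_nat_into)
  then show ?thesis
    using assms(1) False by (metis UN_simps(10) range_from_nat_into)
qed

lemma meager_Un: "meager S \<Longrightarrow> meager T \<Longrightarrow> meager (S \<union> T)"
  using meager_UN[of "{S, T}" id] by auto

text \<open>A closed \<open>H\<close> contains its frontier, so an open subset of the frontier lies
  in \<open>interior H\<close>, which the frontier avoids.\<close>

lemma nowhere_dense_frontier: "closed H \<Longrightarrow> nowhere_dense (frontier H)"
proof -
  assume "closed H"
  then have "interior (frontier H) \<subseteq> interior H \<inter> frontier H"
    by (meson Int_greatest frontier_subset_closed interior_mono interior_subset)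
  then show ?thesis
    by (auto simp: nowhere_dense_def frontier_def closure_closed[OF frontier_closed[unfolded frontier_def]])
qed

text \<open>Finite unions of nowhere dense sets are nowhere dense. Monotonicity matters in the
  meager case of the dichotomy, where avoiding a set with a large index must exclude the earlier
  ones too.\<close>

lemma meager_imp_mono_nowhere_dense:
  assumes "meager S"
  obtains T :: "nat \<Rightarrow> 'a::topological_space set"
  where "\<And>n. nowhere_dense (T n)" "mono T" "S \<subseteq> (\<Union>n. T n)"
proof -
  obtain T :: "nat \<Rightarrow> 'a set" where T: "\<And>n. nowhere_dense (T n)" "S \<subseteq> (\<Union>n. T n)"
    using assms unfolding meager_def by blast
  show thesis
  proof
    show "nowhere_dense (\<Union>i\<le>n. T i)" for n
      by (induction n) (auto simp: T atMost_Suc intro: nowhere_dense_Un)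
    show "mono (\<lambda>n. \<Union>i\<le>n. T i)"
      by (rule monoI) force
    show "S \<subseteq> (\<Union>n. \<Union>i\<le>n. T i)"
      using T(2) by blast
  qed
qed

section \<open>Closed envelopes modulo meager sets\<close>

definition meager_part :: "'a::topological_space set \<Rightarrow> 'a set" where
  "meager_part S = \<Union>{V. open V \<and> meager (V \<inter> S)}"

text \<open>Every open set that meets this set meets \<open>S\<close> in a nonmeager set.\<close>

definition baire_hull :: "'a::topological_space set \<Rightarrow> 'a set" where
  "baire_hull S = closure S - meager_part S"

lemma open_meager_part: "open (meager_part S)"
  unfolding meager_part_def by (rule open_Union) blast

lemma closed_baire_hull: "closed (baire_hull S)"
  unfolding baire_hull_def by (simp add: closed_Diff open_meager_part)

text \<open>Countably many basic open sets suffice to cover \<open>meager_part S\<close>.\<close>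

lemma meager_Int_meager_part:
  fixes S :: "'a::second_countable_topology set"
  shows "meager (meager_part S \<inter> S)"
proof -
  obtain B :: "'a set set" where B: "countable B" "topological_basis B"
    using ex_countable_basis by blast
  have "meager (\<Union>V\<in>{V\<in>B. meager (V \<inter> S)}. V \<inter> S)"
    using B(1) by (intro meager_UN) auto
  moreover have "meager_part S \<inter> S \<subseteq> (\<Union>V\<in>{V\<in>B. meager (V \<inter> S)}. V \<inter> S)"
  proof
    fix x assume "x \<in> meager_part S \<inter> S"
    then obtain V where V: "open V" "meager (V \<inter> S)" "x \<in> V" "x \<in> S"
      unfolding meager_part_def by blast
    then obtain W where "W \<in> B" "x \<in> W" "W \<subseteq> V"
      using topological_basisE[OF B(2)] by blast
    moreover from this V have "meager (W \<inter> S)" by (blast intro: meager_subset)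
    ultimately show "x \<in> (\<Union>V\<in>{V\<in>B. meager (V \<inter> S)}. V \<inter> S)" using V by blast
  qed
  ultimately show ?thesis by (rule meager_subset)
qed

text \<open>A point of \<open>S\<close> outside the interior of its hull lies in
  \<open>meager_part S\<close> or on the frontier of the hull, and both contributions are
  meager.\<close>

lemma nonmeager_interior_baire_hull:
  fixes S :: "'a::second_countable_topology set"
  assumes "\<not> meager (V \<inter> S)"
  shows "V \<inter> interior (baire_hull S) \<noteq> {}"
proof
  assume *: "V \<inter> interior (baire_hull S) = {}"
  have "V \<inter> S \<subseteq> (meager_part S \<inter> S) \<union> frontier (baire_hull S)"
  proof
    fix x assume x: "x \<in> V \<inter> S"
    show "x \<in> (meager_part S \<inter> S) \<union> frontier (baire_hull S)"
    proof (cases "x \<in> meager_part S")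
      case False
      then have "x \<in> baire_hull S"
        using x closure_subset[of S] unfolding baire_hull_def by auto
      then show ?thesis
        using x * frontier_def[of "baire_hull S"] closure_closed[OF closed_baire_hull, of S] by blast
    qed (use x in auto)
  qed
  moreover have "meager ((meager_part S \<inter> S) \<union> frontier (baire_hull S))"
    by (intro meager_Un meager_Int_meager_part nowhere_dense_imp_meager
        nowhere_dense_frontier closed_baire_hull)
  ultimately show False
    using assms meager_subset by blast
qed

text \<open>In the interior of the hull of the union, every nonempty open set meets the union in a
  nonmeager set, so some \<open>S i\<close> is nonmeager there and its hull has interior there. What
  the smaller hulls miss is thus covered by a frontier and a nowhere dense set.\<close>

lemma meager_baire_hull_UN:
  fixes S :: "nat \<Rightarrow> 'a::second_countable_topology set"
  shows "meager (baire_hull (\<Union>i. S i) - (\<Union>i. baire_hull (S i)))" (is "meager (?H - _)")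
proof -
  let ?T = "interior ?H - (\<Union>i. interior (baire_hull (S i)))"
  have "nowhere_dense ?T"
    unfolding nowhere_dense_iff
  proof (intro allI impI)
    fix V :: "'a set"
    assume V: "open V \<and> V \<noteq> {}"
    show "\<exists>W. open W \<and> W \<noteq> {} \<and> W \<subseteq> V \<and> W \<inter> ?T = {}"
    proof (cases "V \<inter> interior ?H = {}")
      case True
      then show ?thesis using V by (intro exI[of _ V]) blast
    next
      case False
      let ?V = "V \<inter> interior ?H"
      have op: "open ?V" using V by auto
      have "\<not> meager (?V \<inter> (\<Union>i. S i))"
      proof
        assume "meager (?V \<inter> (\<Union>i. S i))"
        then have "?V \<subseteq> meager_part (\<Union>i. S i)"
          using op unfolding meager_part_def by blast
        moreover have "?V \<subseteq> - meager_part (\<Union>i. S i)"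
          using interior_subset[of ?H] unfolding baire_hull_def by blast
        ultimately show False using False by blast
      qed
      then obtain i where "\<not> meager (?V \<inter> S i)"
        using meager_UN_nat[of "\<lambda>i. ?V \<inter> S i"] by auto
      then have "?V \<inter> interior (baire_hull (S i)) \<noteq> {}"
        by (rule nonmeager_interior_baire_hull)
      then show ?thesis
        using op by (intro exI[of _ "?V \<inter> interior (baire_hull (S i))"]) auto
    qed
  qed
  then have "meager (frontier ?H \<union> ?T)"
    by (intro meager_Un nowhere_dense_imp_meager nowhere_dense_frontier closed_baire_hull)
  moreover have "?H - (\<Union>i. baire_hull (S i)) \<subseteq> frontier ?H \<union> ?T"
    using frontier_def[of ?H] closure_closed[OF closed_baire_hull, of "\<Union>i. S i"] interior_subset by blast
  ultimately show ?thesis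
    by (rule meager_subset)
qed

text \<open>
  The projection is the union over all branches \<open>\<alpha>\<close> of a tree of closed sets; along the tree,
  replacing the sets by their hulls loses only a meager set at each of the countably many nodes.
\<close>
lemma nonmeager_proj_closed:
  fixes C :: "('a::second_countable_topology \<times> (nat \<Rightarrow> nat)) set"
  assumes C: "closed C" and nm: "\<not> meager (fst ` C)"
  obtains U where "open U" "U \<noteq> {}" "meager (U - fst ` C)"
proof -
  \<comment> \<open>The part of the projection whose witnesses extend the node \<open>s\<close>;
    \<open>N s\<close> collects the points of the hull at \<open>s\<close> that lie in no hull of a
    child.\<close>
  define A where "A s = fst ` {(z, \<alpha>) \<in> C. \<forall>i<length s. \<alpha> i = s ! i}" for s
  define N where "N s = baire_hull (A s) - (\<Union>i. baire_hull (A (s @ [i])))" for s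
  have A_UN: "A s = (\<Union>i. A (s @ [i]))" for s
  proof -
    have "(\<forall>i<length (s @ [k]). \<alpha> i = (s @ [k]) ! i) \<longleftrightarrow>
        (\<forall>i<length s. \<alpha> i = s ! i) \<and> \<alpha> (length s) = k" for \<alpha> :: "nat \<Rightarrow> nat" and k
      by (auto simp: nth_append less_Suc_eq)
    then show ?thesis unfolding A_def by (auto simp: image_iff)
  qed
  have mN: "meager (\<Union>s. N s)"
  proof (rule meager_UN)
    show "meager (N s)" for s
      using meager_baire_hull_UN[of "\<lambda>i. A (s @ [i])"] unfolding N_def A_UN[symmetric] .
  qed auto
  have sub: "baire_hull (A []) - (\<Union>s. N s) \<subseteq> fst ` C"
  proof
    fix z assume z: "z \<in> baire_hull (A []) - (\<Union>s. N s)"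
    \<comment> \<open>Outside all \<open>N s\<close>, a point can always descend to the hull of some
      child; the chosen children spell a branch \<open>\<alpha>\<close>.\<close>
    have ext: "\<exists>k. z \<in> baire_hull (A (s @ [k]))" if "z \<in> baire_hull (A s)" for s
      using that z unfolding N_def by blast
    define step where "step s = s @ [SOME k. z \<in> baire_hull (A (s @ [k]))]" for s
    define s where "s n = (step ^^ n) []" for n
    have s_Suc: "\<exists>k. s (Suc n) = s n @ [k]" for n
      by (simp add: s_def step_def)
    have len: "length (s n) = n" for n
      by (induction n) (auto simp: s_def step_def)
    have in_hull: "z \<in> baire_hull (A (s n))" for n
    proof (induction n)
      case 0
      show ?case using z by (simp add: s_def)
    next
      case (Suc n)
      then show ?case using someI_ex[OF ext] by (simp add: s_def step_def)
    qed
    define \<alpha> where "\<alpha> n = s (Suc n) ! n" for n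
    have nth: "s n ! i = \<alpha> i" if "i < n" for i n
      using that
    proof (induction n)
      case (Suc n)
      obtain k where "s (Suc n) = s n @ [k]" using s_Suc by blast
      then show ?case
        using Suc len[of n] by (cases "i = n") (auto simp: \<alpha>_def nth_append)
    qed simp
    \<comment> \<open>A basic neighbourhood restricts \<open>\<alpha>\<close> only below some
      \<open>n\<close>, and \<open>z\<close> is in the closure of \<open>A (s n)\<close>, so
      \<open>C\<close> meets it.\<close>
    have "(z, \<alpha>) \<in> closure C"
      unfolding closure_iff_nhds_not_empty
    proof (intro allI impI)
      fix P S assume "S \<subseteq> P" "open S" "(z, \<alpha>) \<in> S"
      then obtain V W where VW: "open V" "open W" "z \<in> V" "\<alpha> \<in> W" "V \<times> W \<subseteq> S"
        using open_prod_elim[of S "(z, \<alpha>)"] by (metis mem_Sigma_iff)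
      obtain J where J: "finite J" "\<And>\<beta>. (\<And>i. i \<in> J \<Longrightarrow> \<beta> i = \<alpha> i) \<Longrightarrow> \<beta> \<in> W"
        using open_fun_finite_agree[OF VW(2,4)] by blast
      obtain n where n: "\<And>i. i \<in> J \<Longrightarrow> i < n"
        using J(1) by (metis finite_nat_set_iff_bounded)
      have "z \<in> closure (A (s n))"
        using in_hull[of n] unfolding baire_hull_def by simp
      then obtain z' where "z' \<in> V" "z' \<in> A (s n)"
        using VW by (meson closure_iff_nhds_not_empty disjoint_iff order_refl)
      then obtain \<beta> where \<beta>: "(z', \<beta>) \<in> C" "\<And>i. i < n \<Longrightarrow> \<beta> i = \<alpha> i"
        unfolding A_def by (auto simp: len nth)
      then have "\<beta> \<in> W"
        using J(2) n by blast
      then show "C \<inter> P \<noteq> {}"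
        using VW \<open>z' \<in> V\<close> \<beta>(1) \<open>S \<subseteq> P\<close> by blast
    qed
    then show "z \<in> fst ` C" using C by (force simp: closure_closed)
  qed
  show thesis
  proof
    have A0: "A [] = fst ` C" unfolding A_def by auto
    show "interior (baire_hull (fst ` C)) \<noteq> {}"
      using nonmeager_interior_baire_hull[of UNIV "fst ` C"] nm by simp
    show "meager (interior (baire_hull (fst ` C)) - fst ` C)"
      using sub interior_subset[of "baire_hull (fst ` C)"] unfolding A0
      by (intro meager_subset[OF mN]) blast
  qed simp
qed

section \<open>Borel sets as projections of closed sets\<close>

text \<open>The form of analyticity that the tree argument uses: the witness set is closed instead
  of Borel.\<close>

definition closed_proj :: "'a::topological_space set \<Rightarrow> bool" where
  "closed_proj A \<longleftrightarrow> (\<exists>C :: ('a \<times> (nat \<Rightarrow> nat)) set. closed C \<and> A = fst ` C)"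

lemma closed_imp_closed_proj: "closed A \<Longrightarrow> closed_proj A"
  unfolding closed_proj_def by (intro exI[of _ "A \<times> UNIV"]) (auto simp: closed_Times)

text \<open>Coordinate 0 of the new witness names the index \<open>i\<close>; the remaining ones
  form a witness for \<open>A i\<close>.\<close>

lemma closed_proj_UN:
  assumes "\<And>i::nat. closed_proj (A i)"
  shows "closed_proj (\<Union>i. A i)"
proof -
  obtain C :: "nat \<Rightarrow> ('a \<times> (nat \<Rightarrow> nat)) set"
    where C: "\<And>i. closed (C i)" "\<And>i. A i = fst ` C i"
    using assms unfolding closed_proj_def by metis
  let ?D = "{p. \<forall>i. snd p 0 \<noteq> i \<or> (fst p, \<lambda>n. snd p (Suc n)) \<in> C i}"
  have "closed {p. snd p 0 \<noteq> i \<or> (fst p, \<lambda>n. snd p (Suc n)) \<in> C}"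
    if C: "closed C" for i and C :: "('a \<times> (nat \<Rightarrow> nat)) set"
  proof (rule closed_Collect_disj)
    show "closed {p::'a \<times> (nat \<Rightarrow> nat). snd p 0 \<noteq> i}"
      using closed_vimage[OF _ continuous_on_snd_apply, of "- {i}"]
      by (simp add: vimage_def closed_def open_discrete)
    have "continuous_on UNIV (\<lambda>p::'a \<times> (nat \<Rightarrow> nat). (fst p, \<lambda>n. snd p (Suc n)))"
      by (intro continuous_on_Pair continuous_on_fst continuous_on_id
          continuous_on_coordinatewise_then_product continuous_on_snd_apply)
    then show "closed {p::'a \<times> (nat \<Rightarrow> nat). (fst p, \<lambda>n. snd p (Suc n)) \<in> C}"
      using closed_vimage[OF C] by (simp add: vimage_def)
  qed
  then have "closed ?D"
    using C(1) by (intro closed_Collect_all) auto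
  moreover have "(\<Union>i. A i) = fst ` ?D"
  proof (intro equalityI subsetI)
    fix z assume "z \<in> (\<Union>i. A i)"
    then obtain i \<alpha> where "(z, \<alpha>) \<in> C i" using C(2) by auto
    then show "z \<in> fst ` ?D"
      by (intro image_eqI[of _ _ "(z, case_nat i \<alpha>)"]) auto
  qed (use C(2) in \<open>force\<close>)
  ultimately show ?thesis unfolding closed_proj_def by blast
qed

text \<open>One sequence codes witnesses for all \<open>A i\<close> at once, by pairing.\<close>

lemma closed_proj_INT:
  assumes "\<And>i::nat. closed_proj (A i)"
  shows "closed_proj (\<Inter>i. A i)"
proof -
  obtain C :: "nat \<Rightarrow> ('a \<times> (nat \<Rightarrow> nat)) set"
    where C: "\<And>i. closed (C i)" "\<And>i. A i = fst ` C i"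
    using assms unfolding closed_proj_def by metis
  let ?D = "{p. \<forall>i. (fst p, \<lambda>n. snd p (prod_encode (i, n))) \<in> C i}"
  have "closed {p::'a \<times> (nat \<Rightarrow> nat). (fst p, \<lambda>n. snd p (prod_encode (i, n))) \<in> C i}" for i
  proof -
    have "continuous_on UNIV (\<lambda>p::'a \<times> (nat \<Rightarrow> nat). (fst p, \<lambda>n. snd p (prod_encode (i, n))))"
      by (intro continuous_on_Pair continuous_on_fst continuous_on_id
          continuous_on_coordinatewise_then_product continuous_on_snd_apply)
    then show ?thesis
      using closed_vimage[OF C(1)] by (simp add: vimage_def)
  qed
  then have "closed ?D"
    by (intro closed_Collect_all) auto
  moreover have "(\<Inter>i. A i) = fst ` ?D"
  proof (intro equalityI subsetI)
    fix z assume "z \<in> (\<Inter>i. A i)"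
    then have "\<forall>i. \<exists>\<alpha>. (z, \<alpha>) \<in> C i" using C(2) by force
    then obtain \<alpha> where "\<And>i. (z, \<alpha> i) \<in> C i" by metis
    then show "z \<in> fst ` ?D"
      by (intro image_eqI[of _ _ "(z, \<lambda>k. case prod_decode k of (i, n) \<Rightarrow> \<alpha> i n)"]) auto
  qed (use C(2) in \<open>force\<close>)
  ultimately show ?thesis unfolding closed_proj_def by blast
qed

section \<open>Spaces with a clopen base\<close>

definition zero_dimensional :: "'a::topological_space itself \<Rightarrow> bool" where
  "zero_dimensional _ \<longleftrightarrow>
     (\<forall>U. \<forall>x::'a\<in>U. open U \<longrightarrow> (\<exists>K. open K \<and> closed K \<and> x \<in> K \<and> K \<subseteq> U))"

lemma zero_dimensional_fun:
  "zero_dimensional TYPE('i \<Rightarrow> 'b::discrete_topology)"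
  unfolding zero_dimensional_def
proof (intro allI ballI impI)
  fix U :: "('i \<Rightarrow> 'b) set" and x
  assume "x \<in> U" "open U"
  then obtain J where J: "finite J" "\<And>y. (\<And>i. i \<in> J \<Longrightarrow> y i = x i) \<Longrightarrow> y \<in> U"
    using open_fun_finite_agree by metis
  let ?K = "{y. \<forall>i\<in>J. y i = x i}"
  have "closed {y. y i = x i}" for i
    using closed_vimage[OF _ continuous_on_product_coordinates, of "{x i}" i]
    by (simp add: vimage_def closed_def open_discrete)
  then have "closed (\<Inter>i\<in>J. {y. y i = x i})"
    by (intro closed_INT) simp
  moreover have "(\<Inter>i\<in>J. {y. y i = x i}) = ?K" by auto
  ultimately show "\<exists>K. open K \<and> closed K \<and> x \<in> K \<and> K \<subseteq> U"
    using J by (intro exI[of _ ?K]) (auto simp: open_cylinder)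
qed

lemma zero_dimensional_prod:
  assumes "zero_dimensional TYPE('a::topological_space)" "zero_dimensional TYPE('b::topological_space)"
  shows "zero_dimensional TYPE('a \<times> 'b)"
  unfolding zero_dimensional_def
proof (intro allI ballI impI)
  fix U :: "('a \<times> 'b) set" and p
  assume "p \<in> U" "open U"
  then obtain V W where VW: "open V" "open W" "p \<in> V \<times> W" "V \<times> W \<subseteq> U"
    using open_prod_elim by metis
  then have "fst p \<in> V" "snd p \<in> W" by auto
  then obtain K L where "open K" "closed K" "fst p \<in> K" "K \<subseteq> V" "open L" "closed L" "snd p \<in> L" "L \<subseteq> W"
    using assms VW(1,2) unfolding zero_dimensional_def by meson
  then show "\<exists>K. open K \<and> closed K \<and> p \<in> K \<and> K \<subseteq> U"
    using VW(4) by (intro exI[of _ "K \<times> L"]) (auto simp: open_Times closed_Times mem_Times_iff)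
qed

lemma open_imp_closed_proj:
  fixes U :: "'a::second_countable_topology set"
  assumes "zero_dimensional TYPE('a)" "open U"
  shows "closed_proj U"
proof -
  let ?F = "{K. open K \<and> closed K \<and> K \<subseteq> U}"
  have "U \<subseteq> \<Union>?F"
  proof
    fix x assume "x \<in> U"
    then obtain K where "open K" "closed K" "x \<in> K" "K \<subseteq> U"
      using assms unfolding zero_dimensional_def by meson
    then show "x \<in> \<Union>?F" by blast
  qed
  moreover obtain F where F: "F \<subseteq> ?F" "countable F" "\<Union>F = \<Union>?F"
    by (rule Lindelof[of ?F]) auto
  \<comment> \<open>Inserting the empty set keeps the family nonempty, as its enumeration by
    \<open>from_nat_into\<close> requires.\<close>
  ultimately have U: "U = \<Union>(insert {} F)" by auto
  have "closed_proj (from_nat_into (insert {} F) n)" for n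
    using from_nat_into[of "insert {} F" n] F(1) by (intro closed_imp_closed_proj) auto
  then have "closed_proj (\<Union>n. from_nat_into (insert {} F) n)"
    by (rule closed_proj_UN)
  then show ?thesis
    using U F(2) range_from_nat_into[of "insert {} F"] by simp
qed

lemma borel_imp_closed_proj:
  fixes A :: "'a::second_countable_topology set"
  assumes "zero_dimensional TYPE('a)" "A \<in> sets borel"
  shows "closed_proj A"
proof -
  have "A \<in> sigma_sets UNIV {S. open S}"
    using assms(2) by (simp add: borel_def)
  \<comment> \<open>The property is not preserved by complements in general, so the induction
    carries each set together with its complement.\<close>
  then have "closed_proj A \<and> closed_proj (- A)"
  proof induction
    case (Basic a)
    then show ?case
      by (simp add: open_imp_closed_proj[OF assms(1)] closed_imp_closed_proj closed_Compl)
  next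
    case (Union a)
    then show ?case by (simp add: closed_proj_UN closed_proj_INT)
  qed (auto simp: closed_imp_closed_proj Compl_eq_Diff_UNIV[symmetric])
  then show ?thesis ..
qed

text \<open>Two successive witnesses merge into one, on the even and the odd coordinates.\<close>

lemma closed_proj_fst:
  fixes B :: "('a::topological_space \<times> (nat \<Rightarrow> nat)) set"
  assumes "closed_proj B"
  shows "closed_proj (fst ` B)"
proof -
  obtain C :: "(('a \<times> (nat \<Rightarrow> nat)) \<times> (nat \<Rightarrow> nat)) set"
    where C: "closed C" "B = fst ` C"
    using assms unfolding closed_proj_def by blast
  define g :: "'a \<times> (nat \<Rightarrow> nat) \<Rightarrow> ('a \<times> (nat \<Rightarrow> nat)) \<times> (nat \<Rightarrow> nat)"
    where "g p = ((fst p, \<lambda>n. snd p (2 * n)), \<lambda>n. snd p (2 * n + 1))" for p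
  have "continuous_on UNIV g"
    unfolding g_def
    by (intro continuous_on_Pair continuous_on_fst continuous_on_id
        continuous_on_coordinatewise_then_product continuous_on_snd_apply)
  then have "closed (g -` C)"
    using C(1) by (intro closed_vimage)
  moreover have "fst ` B = fst ` (g -` C)"
  proof (intro equalityI subsetI)
    fix z assume "z \<in> fst ` B"
    then obtain \<alpha> \<beta> where "((z, \<alpha>), \<beta>) \<in> C"
      unfolding C(2) by auto
    then have "(z, \<lambda>n. if even n then \<alpha> (n div 2) else \<beta> (n div 2)) \<in> g -` C"
      by (simp add: g_def)
    then show "z \<in> fst ` (g -` C)" by (rule image_eqI[rotated]) simp
  next
    fix z assume "z \<in> fst ` (g -` C)"
    then obtain p where p: "z = fst p" "p \<in> g -` C" by blast
    then have "fst (g p) \<in> B" unfolding C(2) by (intro imageI) simp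
    then show "z \<in> fst ` B" by (rule image_eqI[rotated]) (simp add: p(1) g_def)
  qed
  ultimately show ?thesis unfolding closed_proj_def by blast
qed

text \<open>The form in which the Baire property enters the dichotomy: reducing the Borel witness to
  a closed one makes the tree argument applicable.\<close>

lemma analytic_nonmeager:
  fixes A :: "('i::countable \<Rightarrow> bool) set"
  assumes "analytic_set A" "\<not> meager A"
  obtains U where "open U" "U \<noteq> {}" "meager (U - A)"
proof -
  have "closed_proj A"
    using assms(1) unfolding analytic_set_def
    by (auto intro!: closed_proj_fst borel_imp_closed_proj zero_dimensional_prod zero_dimensional_fun)
  then obtain C :: "(('i \<Rightarrow> bool) \<times> (nat \<Rightarrow> nat)) set" where C: "closed C" "A = fst ` C"
    unfolding closed_proj_def by blast
  show thesis
    by (rule nonmeager_proj_closed[OF C(1)]) (use assms(2) that C(2) in auto)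
qed

lemma analytic_set_vimage:
  fixes A :: "'b::second_countable_topology set" and g :: "'a::topological_space \<Rightarrow> 'b"
  assumes "analytic_set A" "g \<in> borel_measurable borel"
  shows "analytic_set (g -` A)"
proof -
  obtain B :: "('b \<times> (nat \<Rightarrow> nat)) set" where B: "B \<in> sets borel" "A = fst ` B"
    using assms(1) unfolding analytic_set_def by blast
  have fst: "(fst :: 'a \<times> (nat \<Rightarrow> nat) \<Rightarrow> 'a) \<in> borel_measurable borel"
    by (intro borel_measurable_continuous_onI continuous_intros)
  have snd: "(snd :: 'a \<times> (nat \<Rightarrow> nat) \<Rightarrow> (nat \<Rightarrow> nat)) \<in> borel_measurable borel"
    by (intro borel_measurable_continuous_onI continuous_intros)
  let ?h = "\<lambda>p :: 'a \<times> (nat \<Rightarrow> nat). (g (fst p), snd p)"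
  have "?h \<in> borel_measurable borel"
    by (intro borel_measurable_Pair snd measurable_compose[OF fst assms(2)])
  then have "?h -` B \<in> sets borel"
    using measurable_sets[of ?h borel borel B] B(1) by simp
  moreover have "g -` A = fst ` (?h -` B)"
  proof (intro equalityI subsetI)
    fix z assume "z \<in> g -` A"
    then obtain \<alpha> where "(g z, \<alpha>) \<in> B" unfolding B(2) by auto
    then show "z \<in> fst ` (?h -` B)" by (intro image_eqI[of _ _ "(z, \<alpha>)"]) auto
  qed (force simp: B(2))
  ultimately show ?thesis unfolding analytic_set_def by blast
qed

section \<open>Avoiding nowhere dense sets on disjoint finite blocks\<close>

text \<open>The values on \<open>B\<close> stay free, but there are only finitely many patterns on
  \<open>B\<close>. They are treated one after another, each time extending a condition off
  \<open>B\<close> until that pattern is excluded from \<open>T\<close>.\<close>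

lemma nowhere_dense_avoid:
  fixes T :: "('i \<Rightarrow> bool) set"
  assumes T: "nowhere_dense T" and B: "finite B"
  obtains J p where "finite J" "J \<inter> B = {}" "\<forall>x. (\<forall>i\<in>J. x i = p i) \<longrightarrow> x \<notin> T"
proof -
  have *: "\<exists>J p. finite J \<and> J \<inter> B = {} \<and>
      (\<forall>a\<in>A. \<forall>x. (\<forall>i\<in>B. x i = a i) \<and> (\<forall>i\<in>J. x i = p i) \<longrightarrow> x \<notin> T)"
    if "finite A" for A :: "('i \<Rightarrow> bool) set"
    using that
  proof induction
    case empty
    show ?case by (intro exI[of _ "{}"]) auto
  next
    case (insert a A)
    then obtain J p where J: "finite J" "J \<inter> B = {}"
      and Jp: "\<And>a x. a \<in> A \<Longrightarrow> \<forall>i\<in>B. x i = a i \<Longrightarrow> \<forall>i\<in>J. x i = p i \<Longrightarrow> x \<notin> T"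
      by metis
    \<comment> \<open>The cylinder given by the new pattern on \<open>B\<close> and the condition so
      far is shrunk to avoid \<open>T\<close>; only its new coordinates off \<open>B\<close> are
      kept.\<close>
    define q where "q i = (if i \<in> B then a i else p i)" for i
    have op: "open {x. \<forall>i\<in>B \<union> J. x i = q i}"
      using B J(1) by (intro open_cylinder) simp
    have ne: "{x. \<forall>i\<in>B \<union> J. x i = q i} \<noteq> {}" by blast
    obtain W where W: "open W" "W \<noteq> {}" "W \<subseteq> {x. \<forall>i\<in>B \<union> J. x i = q i}" "W \<inter> T = {}"
      by (rule nowhere_denseE[OF T op ne])
    then obtain y where y: "y \<in> W" by blast
    obtain J' where J': "finite J'" "\<And>x. (\<And>i. i \<in> J' \<Longrightarrow> x i = y i) \<Longrightarrow> x \<in> W"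
      using open_fun_finite_agree[OF W(1) y] by blast
    have yq: "y i = q i" if "i \<in> B \<union> J" for i
      using W(3) y that by blast
    have yB: "y i = a i" if "i \<in> B" for i
      using yq that by (simp add: q_def)
    have yJ: "y i = p i" if "i \<in> J" for i
      using yq[of i] that J(2) by (auto simp: q_def)
    have "x \<notin> T" if b: "b \<in> insert a A" and xB: "\<forall>i\<in>B. x i = b i"
      and xJ: "\<forall>i\<in>J \<union> (J' - B). x i = y i" for b x
    proof (cases "b \<in> A")
      case True
      then show ?thesis using Jp[of b x] xB xJ yJ by simp
    next
      case False
      then have "x i = y i" if "i \<in> J'" for i
        using b xB xJ yB that by (cases "i \<in> B") auto
      then show ?thesis using J'(2) W(4) by blast
    qed
    then show ?case
      using J J'(1) by (intro exI[of _ "J \<union> (J' - B)"] exI[of _ y]) auto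
  qed
  \<comment> \<open>All patterns on \<open>B\<close>, normalized to \<open>False\<close> elsewhere
    so that they form a finite set.\<close>
  let ?A = "(\<lambda>S i. i \<in> S) ` Pow B"
  have "finite ?A" using B by simp
  from *[OF this] obtain J p where J: "finite J" "J \<inter> B = {}"
    and Jp: "\<And>a x. a \<in> ?A \<Longrightarrow> \<forall>i\<in>B. x i = a i \<Longrightarrow> \<forall>i\<in>J. x i = p i \<Longrightarrow> x \<notin> T"
    by metis
  show thesis
  proof
    show "\<forall>x. (\<forall>i\<in>J. x i = p i) \<longrightarrow> x \<notin> T"
    proof (intro allI impI)
      fix x :: "'i \<Rightarrow> bool"
      assume x: "\<forall>i\<in>J. x i = p i"
      have "(\<lambda>i. i \<in> {i \<in> B. x i}) \<in> ?A"
        by (intro image_eqI[of _ _ "{i \<in> B. x i}"]) auto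
      then show "x \<notin> T"
        by (rule Jp) (use x in auto)
    qed
  qed (use J in auto)
qed

text \<open>Greedy choice: the blocks before stage \<open>j\<close> have a finite union, which the
  next block avoids.\<close>

lemma disjoint_blocks:
  fixes S :: "'a \<Rightarrow> 'b set"
  assumes "\<And>j U. finite U \<Longrightarrow> \<exists>a. finite (S a) \<and> S a \<inter> U = {} \<and> P j a"
  obtains a :: "nat \<Rightarrow> 'a"
  where "\<forall>j. finite (S (a j))" "\<forall>j. P j (a j)" "disjoint_family (\<lambda>j. S (a j))"
proof -
  have "\<exists>a. \<forall>j::nat. finite (S (a j)) \<and> S (a j) \<inter> (\<Union>i<j. S (a i)) = {} \<and> P j (a j)"
  proof (rule dependent_wf_choice[OF wf_less_than])
    fix f g :: "nat \<Rightarrow> 'a" and x r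
    assume "\<And>z. (z, x) \<in> less_than \<Longrightarrow> f z = g z"
    then have "(\<Union>i<x. S (f i)) = (\<Union>i<x. S (g i))" by simp
    then show "(finite (S r) \<and> S r \<inter> (\<Union>i<x. S (f i)) = {} \<and> P x r) =
      (finite (S r) \<and> S r \<inter> (\<Union>i<x. S (g i)) = {} \<and> P x r)" by simp
  next
    fix x f
    assume "\<And>y. (y, x) \<in> less_than \<Longrightarrow>
      finite (S (f y)) \<and> S (f y) \<inter> (\<Union>i<y. S (f i)) = {} \<and> P y (f y)"
    then have "finite (\<Union>i<x. S (f i))" by auto
    then show "\<exists>r. finite (S r) \<and> S r \<inter> (\<Union>i<x. S (f i)) = {} \<and> P x r"
      by (rule assms)
  qed
  then obtain a where a: "\<And>j. finite (S (a j))" "\<And>j. P j (a j)"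
      and dis: "\<And>j. S (a j) \<inter> (\<Union>i<j. S (a i)) = {}"
    by blast
  have "S (a i) \<inter> S (a j) = {}" if "i < j" for i j
    using dis[of j] that by blast
  then have "disjoint_family (\<lambda>j. S (a j))"
    unfolding disjoint_family_on_def by (metis Int_commute linorder_neqE_nat)
  with a that show thesis by blast
qed

lemma disjoint_family_glue:
  fixes p :: "'j \<Rightarrow> 'i \<Rightarrow> 'a"
  assumes "disjoint_family J"
  obtains q where "\<forall>j. \<forall>i\<in>J j. q i = p j i" "\<forall>i. (\<forall>j. i \<notin> J j) \<longrightarrow> q i = d"
proof
  let ?q = "\<lambda>i. if \<exists>j. i \<in> J j then p (THE j. i \<in> J j) i else d"
  show "\<forall>j. \<forall>i\<in>J j. ?q i = p j i"
  proof (intro allI ballI)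
    fix i j assume i: "i \<in> J j"
    then have "(THE j. i \<in> J j) = j"
      using assms by (intro the_equality) (auto simp: disjoint_family_on_def)
    then show "?q i = p j i" using i by auto
  qed
qed auto

section \<open>Eventual equality\<close>

lemma E0_iff_finite: "(x, y) \<in> E0 \<longleftrightarrow> finite {k. x k \<noteq> y k}"
  by (simp add: E0_def eventually_cofinite flip: cofinite_eq_sequentially)

lemma equiv_E0: "equiv UNIV E0"
proof (rule equivI)
  show "trans E0"
    by (rule transI) (auto simp: E0_def elim: eventually_elim2)
qed (auto simp: refl_on_def sym_def E0_def eq_commute)

lemma equiv_E0N: "equiv UNIV E0N"
proof (rule equivI)
  show "refl E0N"
    using equiv_E0 by (auto simp: E0N_def refl_on_def equiv_def)
  show "sym E0N"
    using equiv_E0 by (auto simp: E0N_def sym_def equiv_def)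
  show "trans E0N"
    using equiv_E0 unfolding E0N_def equiv_def trans_def by blast
qed simp

lemma continuous_on_apply2:
  "continuous_on UNIV (\<lambda>x :: 'i \<Rightarrow> 'j \<Rightarrow> 'b::topological_space. x n l)"
  by (rule continuous_on_product_then_coordinatewise[where f = "\<lambda>x. x n",
        OF continuous_on_product_coordinates])

text \<open>Agreement of row \<open>n\<close> from position \<open>m\<close> on is closed; take the
  union over \<open>m\<close> and then the intersection over \<open>n\<close>.\<close>

lemma borel_equiv_E0N: "borel_equiv E0N"
proof -
  let ?D = "\<lambda>n k. {p :: (nat \<Rightarrow> nat \<Rightarrow> bool) \<times> (nat \<Rightarrow> nat \<Rightarrow> bool). fst p n k = snd p n k}"
  have "closed (?D n k)" for n k
  proof (rule closed_Collect_eq)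
    show "continuous_on UNIV (\<lambda>p :: (nat \<Rightarrow> nat \<Rightarrow> bool) \<times> (nat \<Rightarrow> nat \<Rightarrow> bool). fst p n k)"
      by (rule continuous_on_compose2[OF continuous_on_apply2 continuous_on_fst[OF continuous_on_id]]) simp
    show "continuous_on UNIV (\<lambda>p :: (nat \<Rightarrow> nat \<Rightarrow> bool) \<times> (nat \<Rightarrow> nat \<Rightarrow> bool). snd p n k)"
      by (rule continuous_on_compose2[OF continuous_on_apply2 continuous_on_snd[OF continuous_on_id]]) simp
  qed
  then have D: "?D n k \<in> sets borel" for n k
    by (rule borel_closed)
  have "(\<Inter>k. ?D n (m + k)) \<in> sets borel" for n m
    using D by (intro sets.countable_INT'') auto
  then have "(\<Union>m. \<Inter>k. ?D n (m + k)) \<in> sets borel" for n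
    by (intro sets.countable_UN) auto
  then have "(\<Inter>n. \<Union>m. \<Inter>k. ?D n (m + k)) \<in> sets borel"
    by (intro sets.countable_INT'') auto
  moreover have "E0N = (\<Inter>n. \<Union>m. \<Inter>k. ?D n (m + k))"
    by (simp add: E0N_def E0_def eventually_sequentially le_iff_add set_eq_iff) metis
  ultimately show ?thesis
    unfolding borel_equiv_def using equiv_E0N by simp
qed

section \<open>The dichotomy\<close>

text \<open>
  A point of \<^typ>\<open>bool \<times> nat \<times> nat \<Rightarrow> bool\<close> encodes a pair of points of \<^typ>\<open>nat \<Rightarrow> nat \<Rightarrow> bool\<close>.
\<close>

definition left_pt :: "(bool \<times> nat \<times> nat \<Rightarrow> bool) \<Rightarrow> nat \<Rightarrow> nat \<Rightarrow> bool" where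
  "left_pt z = (\<lambda>k m. z (False, k, m))"

definition right_pt :: "(bool \<times> nat \<times> nat \<Rightarrow> bool) \<Rightarrow> nat \<Rightarrow> nat \<Rightarrow> bool" where
  "right_pt z = (\<lambda>k m. z (True, k, m))"

text \<open>The shift by \<open>n\<close> lets every row of \<open>v\<close> occur, so the second
  half of a code consists of free coordinates for each \<open>n\<close>.\<close>

definition graft :: "nat \<Rightarrow> (nat \<Rightarrow> 'a) \<Rightarrow> (nat \<Rightarrow> 'a) \<Rightarrow> nat \<Rightarrow> 'a" where
  "graft n u v = (\<lambda>k. if k < n then u k else v (k - n))"

text \<open>The set \<open>R n\<close> of the introduction, in coded form.\<close>

definition tail_rel :: "((nat \<Rightarrow> nat \<Rightarrow> bool) \<Rightarrow> 'b) \<Rightarrow> 'b rel \<Rightarrow> nat \<Rightarrow> (bool \<times> nat \<times> nat \<Rightarrow> bool) set" where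
  "tail_rel f E n = {z. (f (left_pt z), f (graft n (left_pt z) (right_pt z))) \<in> E}"

lemma graft_E0N_iff: "(graft n u v, graft n u v') \<in> E0N \<longleftrightarrow> (v, v') \<in> E0N"
proof
  assume *: "(graft n u v, graft n u v') \<in> E0N"
  have "(v k, v' k) \<in> E0" for k
    using *[unfolded E0N_def, simplified, rule_format, of "n + k"] by (simp add: graft_def)
  then show "(v, v') \<in> E0N" by (simp add: E0N_def)
next
  assume "(v, v') \<in> E0N"
  then show "(graft n u v, graft n u v') \<in> E0N"
    using equiv_E0 by (auto simp: E0N_def graft_def equiv_def refl_on_def)
qed

lemma borel_measurable_bool_fun2:
  fixes g :: "'a::topological_space \<Rightarrow> nat \<Rightarrow> nat \<Rightarrow> bool"
  assumes "\<And>k m. continuous_on UNIV (\<lambda>x. g x k m)"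
  shows "g \<in> borel_measurable borel"
  by (intro borel_measurable_continuous_onI continuous_on_coordinatewise_then_product assms)

lemma analytic_set_tail_rel:
  fixes f :: "(nat \<Rightarrow> nat \<Rightarrow> bool) \<Rightarrow> 'b::polish_space"
  assumes "analytic_set E" "f \<in> borel_measurable borel"
  shows "analytic_set (tail_rel f E n)"
proof -
  have left: "left_pt \<in> borel_measurable borel"
    by (intro borel_measurable_bool_fun2) (simp add: left_pt_def)
  have "continuous_on UNIV (\<lambda>z. graft n (left_pt z) (right_pt z) k m)" for k m
    by (cases "k < n") (simp_all add: graft_def left_pt_def right_pt_def)
  then have right: "(\<lambda>z. graft n (left_pt z) (right_pt z)) \<in> borel_measurable borel"
    by (rule borel_measurable_bool_fun2)
  have "(\<lambda>z. (f (left_pt z), f (graft n (left_pt z) (right_pt z)))) \<in> borel_measurable borel"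
    by (intro borel_measurable_Pair measurable_compose[OF left assms(2)]
        measurable_compose[OF right assms(2)])
  from analytic_set_vimage[OF assms(1) this] show ?thesis
    by (simp add: tail_rel_def vimage_def)
qed

section \<open>The nonmeager case\<close>

lemma reducible_to_class_if_nonmeager:
  fixes f :: "(nat \<Rightarrow> nat \<Rightarrow> bool) \<Rightarrow> 'b::polish_space"
  assumes E: "analytic_equiv E" and f: "f \<in> borel_measurable borel"
    and nm: "\<not> meager (tail_rel f E n)"
  shows "\<exists>y. borel_reducible borel E0N
           (restrict_space borel {x. (f x, y) \<in> E}) (Restr E0N {x. (f x, y) \<in> E})"
proof -
  obtain U where U: "open U" "U \<noteq> {}" "meager (U - tail_rel f E n)"
    using analytic_nonmeager[OF analytic_set_tail_rel nm] E f unfolding analytic_equiv_def by blast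
  then obtain s where "s \<in> U" by blast
  obtain B where B: "finite B" "\<And>z. (\<And>i. i \<in> B \<Longrightarrow> z i = s i) \<Longrightarrow> z \<in> U"
    using open_fun_finite_agree[OF U(1) \<open>s \<in> U\<close>] by blast
  obtain T :: "nat \<Rightarrow> (bool \<times> nat \<times> nat \<Rightarrow> bool) set"
    where T: "\<And>j. nowhere_dense (T j)" "U - tail_rel f E n \<subseteq> (\<Union>j. T j)"
    using U(3) unfolding meager_def by blast
  define S where "S = (\<lambda>(J :: (bool \<times> nat \<times> nat) set, p :: bool \<times> nat \<times> nat \<Rightarrow> bool, c). insert c J)"
  \<comment> \<open>Block \<open>J\<close> with pattern \<open>p\<close> forces a point out of
    \<open>T j\<close>, and the extra coordinate \<open>c\<close> is left free to store one bit. If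
    \<open>prod_decode j = (k, l)\<close>, then \<open>c\<close> lies in row \<open>k\<close> of the
    right half and will hold \<open>w k l\<close>.\<close>
  define P where "P = (\<lambda>j (J, p, c). insert c J \<inter> B = {} \<and> c \<notin> J \<and>
    (\<exists>m. c = (True, fst (prod_decode j), m)) \<and> (\<forall>z. (\<forall>i\<in>J. z i = p i) \<longrightarrow> z \<notin> T j))"
  have step: "\<exists>a. finite (S a) \<and> S a \<inter> V = {} \<and> P j a" if V: "finite V" for j V
  proof -
    have fin: "finite (V \<union> B)" using V B(1) by simp
    obtain J p where J: "finite J" "J \<inter> (V \<union> B) = {}"
      "\<forall>z. (\<forall>i\<in>J. z i = p i) \<longrightarrow> z \<notin> T j"
      by (rule nowhere_dense_avoid[OF T(1)[of j] fin])
    have "infinite (range (\<lambda>m. (True, fst (prod_decode j), m :: nat)))"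
      by (intro range_inj_infinite injI) simp
    moreover have "finite (V \<union> B \<union> J)" using V B(1) J(1) by simp
    ultimately obtain c where "c \<in> range (\<lambda>m. (True, fst (prod_decode j), m))" "c \<notin> V \<union> B \<union> J"
      by (meson finite_subset subsetI)
    then show ?thesis
      using J by (intro exI[of _ "(J, p, c)"]) (auto simp: S_def P_def)
  qed
  obtain a where a: "\<forall>j. finite (S (a j))" "\<forall>j. P j (a j)" "disjoint_family (\<lambda>j. S (a j))"
    by (rule disjoint_blocks[of S P, OF step])
  define J where "J j = fst (a j)" for j
  define p where "p j = fst (snd (a j))" for j
  define c where "c j = snd (snd (a j))" for j
  have S: "S (a j) = insert (c j) (J j)" for j
    by (simp add: S_def J_def c_def split: prod.split)
  have P: "insert (c j) (J j) \<inter> B = {}" "c j \<notin> J j" "\<exists>m. c j = (True, fst (prod_decode j), m)"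
    "(\<forall>i\<in>J j. z i = p j i) \<longrightarrow> z \<notin> T j" for j z
    using a(2)[rule_format, of j] by (simp_all add: P_def J_def p_def c_def split: prod.splits)
  have disj: "insert (c i) (J i) \<inter> insert (c j) (J j) = {}" if "i \<noteq> j" for i j
    using a(3) that unfolding S disjoint_family_on_def by blast
  then have "disjoint_family J"
    unfolding disjoint_family_on_def by blast
  then obtain q where "\<forall>j. \<forall>i\<in>J j. q i = p j i"
    by (rule disjoint_family_glue)
  then have q: "q i = p j i" if "i \<in> J j" for i j
    using that by blast
  have cJ: "c i \<notin> J j" for i j
    using disj[of i j] P(2)[of i] by (cases "i = j") auto
  have inj: "inj c"
    using disj by (intro injI) (metis insert_disjoint(1) insertI1)
  \<comment> \<open>The free coordinates carry \<open>w\<close>, the values of \<open>s\<close> on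
    \<open>B\<close> keep the point in \<open>U\<close>, and \<open>q\<close> supplies the patterns
    on the blocks. All coordinates outside the range of \<open>c\<close> are independent of
    \<open>w\<close>.\<close>
  define z where "z w i = (if i \<in> range c then case prod_decode (inv c i) of (k, l) \<Rightarrow> w k l
    else if i \<in> B then s i else q i)" for w :: "nat \<Rightarrow> nat \<Rightarrow> bool" and i
  have zc: "z w (c (prod_encode (k, l))) = w k l" for w k l
    by (simp add: z_def inv_f_f[OF inj])
  have z_fixed: "z w i = z w' i" if "i \<notin> range c" for w w' i
    using that by (simp add: z_def)
  have z_tail: "z w \<in> tail_rel f E n" for w
  proof -
    have "z w \<in> U"
      using P(1) by (intro B(2)) (auto simp: z_def)
    moreover have "z w \<notin> T j" for j
    proof -
      have "z w i = p j i" if "i \<in> J j" for i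
        using that P(1)[of j] cJ q[OF that] by (auto simp: z_def)
      then show ?thesis using P(4) by blast
    qed
    ultimately show ?thesis using T(2) by blast
  qed
  define u where "u = left_pt (z (\<lambda>_ _. False))"
  have z_left: "left_pt (z w) = u" for w
  proof -
    \<comment> \<open>Bits are stored only under the tag \<open>True\<close>, so the left half stays
      constant.\<close>
    have "(False, k, m) \<notin> range c" for k m
    proof
      assume "(False, k, m) \<in> range c"
      then obtain j where "c j = (False, k, m)" by (metis rangeE)
      then show False using P(3)[of j] by auto
    qed
    then show ?thesis
      unfolding u_def left_pt_def using z_fixed by blast
  qed
  define g where "g w = graft n u (right_pt (z w))" for w
  \<comment> \<open>With the left half always equal to \<open>u\<close>, membership in
    \<open>tail_rel f E n\<close> ties every \<open>f (g w)\<close> to the single class of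
    \<open>f u\<close>.\<close>
  have g_class: "(f (g w), f u) \<in> E" for w
    using z_tail[of w] E unfolding tail_rel_def g_def analytic_equiv_def
    by (auto simp: z_left dest: equivE symD)
  obtain m where m: "\<And>j. c j = (True, fst (prod_decode j), m j)"
    using P(3) by metis
  \<comment> \<open>Each bit of row \<open>k\<close> is stored once, in row \<open>k\<close>, and
    the rest is constant; the relocation is injective, so finiteness of difference sets is preserved
    both ways.\<close>
  have diff: "{i. right_pt (z w) k i \<noteq> right_pt (z w') k i} =
      (\<lambda>l. m (prod_encode (k, l))) ` {l. w k l \<noteq> w' k l}" for w w' k
  proof (intro equalityI subsetI)
    fix i assume "i \<in> {i. right_pt (z w) k i \<noteq> right_pt (z w') k i}"
    then have ne: "z w (True, k, i) \<noteq> z w' (True, k, i)" by (simp add: right_pt_def)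
    then obtain j where j: "c j = (True, k, i)" using z_fixed by (metis rangeE)
    then have "prod_encode (k, snd (prod_decode j)) = j" "m j = i"
      using m[of j] by auto
    then show "i \<in> (\<lambda>l. m (prod_encode (k, l))) ` {l. w k l \<noteq> w' k l}"
      using ne zc j by (intro image_eqI[of _ _ "snd (prod_decode j)"]) (auto, metis+)
  next
    fix i assume "i \<in> (\<lambda>l. m (prod_encode (k, l))) ` {l. w k l \<noteq> w' k l}"
    then obtain l where l: "w k l \<noteq> w' k l" "i = m (prod_encode (k, l))" by blast
    then show "i \<in> {i. right_pt (z w) k i \<noteq> right_pt (z w') k i}"
      using zc[of _ k l] m[of "prod_encode (k, l)"] by (simp add: right_pt_def)
  qed
  have "inj_on (\<lambda>l. m (prod_encode (k, l))) A" for k A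
  proof (rule inj_onI)
    fix l l' assume "m (prod_encode (k, l)) = m (prod_encode (k, l'))"
    then have "c (prod_encode (k, l)) = c (prod_encode (k, l'))"
      using m by simp
    then show "l = l'" using inj by (simp add: inj_eq)
  qed
  then have "(right_pt (z w) k, right_pt (z w') k) \<in> E0 \<longleftrightarrow> (w k, w' k) \<in> E0" for w w' k
    unfolding E0_iff_finite diff by (rule finite_image_iff)
  then have red: "(g w, g w') \<in> E0N \<longleftrightarrow> (w, w') \<in> E0N" for w w'
    unfolding g_def graft_E0N_iff by (simp add: E0N_def)
  have "continuous_on UNIV (\<lambda>w. z w i)" for i
  proof (cases "i \<in> range c")
    case True
    then show ?thesis
      using continuous_on_apply2 by (simp add: z_def case_prod_beta)
  qed (simp add: z_def)
  then have "continuous_on UNIV (\<lambda>w. g w k i)" for k i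
    by (cases "k < n") (simp_all add: g_def graft_def right_pt_def)
  then have "g \<in> borel_measurable borel"
    by (rule borel_measurable_bool_fun2)
  then have "g \<in> measurable borel (restrict_space borel {x. (f x, f u) \<in> E})"
    using g_class by (intro measurable_restrict_space2) auto
  then show ?thesis
    unfolding borel_reducible_def using red g_class
    by (intro exI[of _ "f u"] bexI[of _ g]) auto
qed

section \<open>The meager case\<close>

lemma reducible_if_meager:
  fixes f :: "(nat \<Rightarrow> nat \<Rightarrow> bool) \<Rightarrow> 'b::polish_space"
  assumes E: "equiv UNIV E" and f: "f \<in> borel_measurable borel" and hom: "rel_hom E0N E f"
    and meager: "\<And>n. meager (tail_rel f E n)"
  shows "borel_reducible borel E0N borel E"
proof -
  have "\<exists>T :: nat \<Rightarrow> (bool \<times> nat \<times> nat \<Rightarrow> bool) set.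
      (\<forall>l. nowhere_dense (T l)) \<and> mono T \<and> tail_rel f E n \<subseteq> (\<Union>l. T l)" for n
    using meager_imp_mono_nowhere_dense[OF meager[of n]] by metis
  then obtain T :: "nat \<Rightarrow> nat \<Rightarrow> (bool \<times> nat \<times> nat \<Rightarrow> bool) set"
    where T: "\<And>n l. nowhere_dense (T n l)" "\<And>n. mono (T n)" "\<And>n. tail_rel f E n \<subseteq> (\<Union>l. T n l)"
    by metis
  \<comment> \<open>The place that a coordinate of a code occupies when the right half is grafted at
    row \<open>n\<close>. A left and a right coordinate may share a place, hence two patterns on one
    block of places.\<close>
  define cell where "cell n i = (case i of (b, k, m) \<Rightarrow> (if b then n + k else k, m))"
    for n :: nat and i :: "bool \<times> nat \<times> nat"
  define P where "P = (\<lambda>j (K, p). case prod_decode j of (n, l) \<Rightarrow>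
    \<forall>z. (\<forall>i. cell n i \<in> K \<longrightarrow> z i = p i) \<longrightarrow> z \<notin> T n l)"
  have step: "\<exists>a. finite (fst a) \<and> fst a \<inter> V = {} \<and> P j a"
    if V: "finite V" for j and V :: "(nat \<times> nat) set"
  proof -
    obtain n l where nl: "prod_decode j = (n, l)" by fastforce
    \<comment> \<open>Given the tag, a place has at most one preimage; truncated subtraction merely
      enlarges the finite superset.\<close>
    have "cell n -` V \<subseteq> (\<lambda>(b, r, m). (b, if b then r - n else r, m)) ` (UNIV \<times> V)"
    proof
      fix i assume i: "i \<in> cell n -` V"
      obtain b k m where "i = (b, k, m)" by (cases i)
      then show "i \<in> (\<lambda>(b, r, m). (b, if b then r - n else r, m)) ` (UNIV \<times> V)"
        using i by (intro image_eqI[of _ _ "(b, cell n i)"]) (auto simp: cell_def)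
    qed
    then have fin: "finite (cell n -` V)"
      by (rule finite_subset) (use V in simp)
    obtain J p where J: "finite J" "J \<inter> cell n -` V = {}"
      "\<forall>z. (\<forall>i\<in>J. z i = p i) \<longrightarrow> z \<notin> T n l"
      by (rule nowhere_dense_avoid[OF T(1)[of n l] fin])
    have "z \<notin> T n l" if z: "\<forall>i. cell n i \<in> cell n ` J \<longrightarrow> z i = p i" for z
    proof -
      have "z i = p i" if "i \<in> J" for i
        using spec[OF z, of i] that by simp
      then show ?thesis using J(3) by simp
    qed
    then have "P j (cell n ` J, p)"
      by (simp add: P_def nl)
    then show ?thesis
      using J(1,2) by (intro exI[of _ "(cell n ` J, p)"]) auto
  qed
  obtain a where a: "\<forall>j. finite (fst (a j))" "\<forall>j. P j (a j)" "disjoint_family (\<lambda>j. fst (a j))"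
    by (rule disjoint_blocks[of fst P, OF step])
  define K where "K n l = fst (a (prod_encode (n, l)))" for n l
  define p where "p n l = snd (a (prod_encode (n, l)))" for n l
  have K: "finite (K n l)" for n l
    using a(1) by (simp add: K_def)
  have avoid: "z \<notin> T n l" if "\<And>i. cell n i \<in> K n l \<Longrightarrow> z i = p n l i" for z n l
    using a(2)[rule_format, of "prod_encode (n, l)"] that by (simp add: P_def K_def p_def case_prod_beta)
  \<comment> \<open>Rows below \<open>n\<close> show the left pattern whatever the bit is, so row
    \<open>k\<close> of the image is affected only by rows of \<open>x\<close> up to
    \<open>k\<close>.\<close>
  define val where "val n l x = (\<lambda>(k, m). if x n l \<and> n \<le> k then p n l (True, k - n, m)
    else p n l (False, k, m))" for n l and x :: "nat \<Rightarrow> nat \<Rightarrow> bool"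
  \<comment> \<open>The glued values are functions of \<open>x\<close>; a place in no block is
    constantly \<open>False\<close>.\<close>
  obtain q where q: "\<forall>j. \<forall>i\<in>fst (a j). q i = (case prod_decode j of (n, l) \<Rightarrow> \<lambda>x. val n l x i)"
    and q0: "\<forall>i. (\<forall>j. i \<notin> fst (a j)) \<longrightarrow> q i = (\<lambda>x. False)"
    by (rule disjoint_family_glue[OF a(3)])
  define \<phi> where "\<phi> x k m = q (k, m) x" for x k m
  have \<phi>_val: "\<phi> x k m = val n l x (k, m)" if "(k, m) \<in> K n l" for x k m n l
    using q that by (simp add: \<phi>_def K_def)
  have \<phi>_cases: "(\<exists>n l. (k, m) \<in> K n l) \<or> (\<forall>x. \<phi> x k m = False)" for k m
  proof (rule disjCI)
    assume *: "\<not> (\<forall>x. \<phi> x k m = False)"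
    have "\<exists>j. (k, m) \<in> fst (a j)"
    proof (rule ccontr)
      assume "\<nexists>j. (k, m) \<in> fst (a j)"
      then have "q (k, m) = (\<lambda>x. False)" using q0 by simp
      then show False using * by (simp add: \<phi>_def)
    qed
    then obtain j where "(k, m) \<in> fst (a j)" ..
    then have "(k, m) \<in> K (fst (prod_decode j)) (snd (prod_decode j))"
      by (simp add: K_def)
    then show "\<exists>n l. (k, m) \<in> K n l" by blast
  qed
  have \<phi>_E0: "(\<phi> x k, \<phi> y k) \<in> E0" if "\<And>n. n \<le> k \<Longrightarrow> (x n, y n) \<in> E0" for x y k
  proof -
    \<comment> \<open>In row \<open>k\<close>, a block \<open>(n, l)\<close> can change only if
      \<open>n \<le> k\<close> and \<open>x n l \<noteq> y n l\<close>, which leaves finitely many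
      finite blocks.\<close>
    let ?D = "\<Union>n\<in>{..k}. \<Union>l\<in>{l. x n l \<noteq> y n l}. snd ` K n l"
    have "{m. \<phi> x k m \<noteq> \<phi> y k m} \<subseteq> ?D"
    proof
      fix m assume "m \<in> {m. \<phi> x k m \<noteq> \<phi> y k m}"
      then have ne: "\<phi> x k m \<noteq> \<phi> y k m" by simp
      then obtain n l where nl: "(k, m) \<in> K n l" using \<phi>_cases by blast
      then have "val n l x (k, m) \<noteq> val n l y (k, m)" using ne \<phi>_val by simp
      then have "n \<le> k" "x n l \<noteq> y n l" by (auto simp: val_def split: if_splits)
      then show "m \<in> ?D" using nl by force
    qed
    moreover have "finite ?D"
      using that K by (auto simp: E0_iff_finite)
    ultimately show ?thesis
      unfolding E0_iff_finite by (rule finite_subset)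
  qed
  \<comment> \<open>If \<open>x n l\<close> is false and \<open>y n l\<close> is true, block
    \<open>(n, l)\<close> shows the left pattern in \<open>\<phi> x\<close> and, from row
    \<open>n\<close> on, the right pattern in \<open>\<phi> y\<close>. So the pair coded by
    \<open>z\<close> avoids \<open>T n l\<close>, while equivalence of the values would put it into
    \<open>tail_rel f E n\<close>.\<close>
  have differ: "(f (\<phi> x), f (\<phi> y)) \<notin> E"
    if low: "\<And>k. k < n \<Longrightarrow> (x k, y k) \<in> E0" and inf: "infinite {l. \<not> x n l \<and> y n l}" for x y n
  proof
    assume xy: "(f (\<phi> x), f (\<phi> y)) \<in> E"
    define z where "z = (\<lambda>(b, k, m). if b then \<phi> y (n + k) m else \<phi> x k m)"
    have left: "left_pt z = \<phi> x"
      by (simp add: left_pt_def z_def)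
    \<comment> \<open>The rows below \<open>n\<close> are equivalent by \<open>\<phi>_E0\<close>;
      from \<open>n\<close> on the graft equals \<open>\<phi> y\<close>.\<close>
    have "(\<phi> y, graft n (left_pt z) (right_pt z)) \<in> E0N"
      unfolding E0N_def
    proof (clarify)
      fix k
      show "(\<phi> y k, graft n (left_pt z) (right_pt z) k) \<in> E0"
      proof (cases "k < n")
        case True
        then have "(\<phi> x k, \<phi> y k) \<in> E0" using low by (intro \<phi>_E0) simp
        then show ?thesis
          using True equiv_E0 by (auto simp: graft_def left equiv_def dest: symD)
      next
        case False
        then show ?thesis
          using equiv_E0 by (auto simp: graft_def right_pt_def z_def equiv_def refl_on_def)
      qed
    qed
    then have "(f (\<phi> y), f (graft n (left_pt z) (right_pt z))) \<in> E"
      using hom unfolding rel_hom_def by blast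
    then have "z \<in> tail_rel f E n"
      using xy E by (auto simp: tail_rel_def left elim!: equivE dest: transD)
    then obtain l0 where l0: "z \<in> T n l0" using T(3) by blast
    \<comment> \<open>Since \<open>T n\<close> is increasing, one suitable \<open>l\<close> beyond
      \<open>l0\<close> gives the contradiction.\<close>
    obtain l where l: "l0 \<le> l" "\<not> x n l" "y n l"
      using inf unfolding infinite_nat_iff_unbounded_le by blast
    have "z i = p n l i" if "cell n i \<in> K n l" for i
    proof -
      obtain b k m where i: "i = (b, k, m)" by (cases i)
      show ?thesis
        using that l \<phi>_val[of _ m n l] by (cases b) (auto simp: i z_def cell_def val_def)
    qed
    then have "z \<notin> T n l" by (rule avoid)
    then show False
      using l0 l(1) monoD[OF T(2) l(1)] by blast
  qed
  have red: "(x, y) \<in> E0N \<longleftrightarrow> (f (\<phi> x), f (\<phi> y)) \<in> E" for x y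
  proof
    assume "(x, y) \<in> E0N"
    then have "(\<phi> x, \<phi> y) \<in> E0N" using \<phi>_E0 by (simp add: E0N_def)
    then show "(f (\<phi> x), f (\<phi> y)) \<in> E" using hom unfolding rel_hom_def by blast
  next
    assume xy: "(f (\<phi> x), f (\<phi> y)) \<in> E"
    show "(x, y) \<in> E0N"
    proof (rule ccontr)
      assume "(x, y) \<notin> E0N"
      then have ex: "\<exists>n. (x n, y n) \<notin> E0" by (simp add: E0N_def)
      \<comment> \<open>Minimality supplies the equivalence of the earlier rows that
        \<open>differ\<close> requires.\<close>
      define n where "n = (LEAST n. (x n, y n) \<notin> E0)"
      have n: "(x n, y n) \<notin> E0"
        unfolding n_def using ex by (rule LeastI_ex)
      have low: "(x k, y k) \<in> E0" if "k < n" for k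
        using that not_less_Least unfolding n_def by blast
      then have low': "(y k, x k) \<in> E0" if "k < n" for k
        using that equiv_E0 by (meson equivE symD)
      have eq: "{l. x n l \<noteq> y n l} = {l. \<not> x n l \<and> y n l} \<union> {l. \<not> y n l \<and> x n l}" by auto
      \<comment> \<open>An infinite difference set has infinitely many positions of one orientation,
        which decides the order of the pair in \<open>differ\<close>.\<close>
      consider "infinite {l. \<not> x n l \<and> y n l}" | "infinite {l. \<not> y n l \<and> x n l}"
        using n unfolding E0_iff_finite eq finite_Un by argo
      then show False
      proof cases
        case 1
        show False using differ[of n x y] low 1 xy by simp
      next
        case 2
        then have "(f (\<phi> y), f (\<phi> x)) \<notin> E" using differ[of n y x] low' by simp
        then show False using xy E by (meson equivE symD)
      qed
    qed
  qed
  \<comment> \<open>Each coordinate of \<open>\<phi> x\<close> is constant or a function of a single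
    bit of \<open>x\<close>.\<close>
  have "continuous_on UNIV (\<lambda>x. \<phi> x k m)" for k m
    using \<phi>_cases[of k m]
  proof
    assume "\<exists>n l. (k, m) \<in> K n l"
    then obtain n l where "(k, m) \<in> K n l" by blast
    then have "\<phi> x k m =
        (\<lambda>b. if b \<and> n \<le> k then p n l (True, k - n, m) else p n l (False, k, m)) (x n l)" for x
      by (simp add: \<phi>_val val_def)
    then show ?thesis
      using continuous_on_discrete_comp[OF continuous_on_apply2,
          of "\<lambda>b. if b \<and> n \<le> k then p n l (True, k - n, m) else p n l (False, k, m)" n l]
      by simp
  qed simp
  then have "\<phi> \<in> borel_measurable borel"
    by (rule borel_measurable_bool_fun2)
  then have "(\<lambda>x. f (\<phi> x)) \<in> borel_measurable borel"
    using f by (rule measurable_compose)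
  then show ?thesis
    unfolding borel_reducible_def using red by (intro bexI[of _ "\<lambda>x. f (\<phi> x)"]) auto
qed

lemma borel_imp_analytic_set:
  assumes "E \<in> sets (borel :: 'a::topological_space measure)"
  shows "analytic_set E"
proof -
  have "(fst :: 'a \<times> (nat \<Rightarrow> nat) \<Rightarrow> 'a) \<in> borel_measurable borel"
    by (intro borel_measurable_continuous_onI continuous_intros)
  then have "(fst :: 'a \<times> (nat \<Rightarrow> nat) \<Rightarrow> 'a) -` E \<in> sets borel"
    using measurable_sets[of fst borel borel E] assms by fastforce
  moreover have "E = fst ` ((fst :: 'a \<times> (nat \<Rightarrow> nat) \<Rightarrow> 'a) -` E)"
    by (simp add: image_vimage_eq)
  ultimately show ?thesis
    unfolding analytic_set_def by blast
qed

lemma analytic_equiv_dichotomy: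
  fixes E :: "'b::polish_space rel"
  assumes E: "analytic_equiv E"
  shows "borel_reducible borel E0N borel E \<or> prime_to E0N E"
proof (rule disjCI)
  assume np: "\<not> prime_to E0N E"
  then obtain f where f: "f \<in> borel_measurable borel" "rel_hom E0N E f"
    and *: "\<not> (\<exists>y. borel_reducible borel E0N (restrict_space borel {x. (f x, y) \<in> E})
       (Restr E0N {x. (f x, y) \<in> E}))"
    unfolding prime_to_def by blast
  have "meager (tail_rel f E n)" for n
    using reducible_to_class_if_nonmeager[OF E f(1)] * by blast
  then show "borel_reducible borel E0N borel E"
    using E f unfolding analytic_equiv_def by (intro reducible_if_meager) auto
qed

theorem theorem1p4:
  "(\<forall>E :: 'b::polish_space rel. analytic_equiv E \<longrightarrow>
      borel_reducible borel E0N borel E \<or> prime_to E0N E) \<and>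
   prime_equiv TYPE('c::polish_space) E0N"
  \<comment> \<open>Borel equivalence relations are analytic, so primeness is an instance of the
    dichotomy.\<close>
  unfolding prime_equiv_def
  using analytic_equiv_dichotomy borel_equiv_E0N borel_imp_analytic_set
  by (metis analytic_equiv_def borel_equiv_def)

end
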